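(* Let $X$ be a compact metric space that is semi-locally connected, and let $f:X\to X$ be a homeomorphism. Then $f$ is equicontinuous if and only if $f$ satisfies property (CW).
   Context: Let $(X,d)$ be a compact metric space and $f:X\to X$ a homeomorphism; $f^n$ denotes the $n$-th iterate for $n\in\mathbb{Z}$. For $p\in X$ and nonempty $B\subset X$, $dist(p,B)=\inf\{d(p,b):b\in B\}$. A subcontinuum of $X$ is a nonempty compact connected subset of $X$. $f$ is equicontinuous if for every $\epsilon>0$ there is $\delta>0$ such that $d(f^n(x),f^n(y))\leq\epsilon$ for all $n\in\mathbb{Z}$ whenever $x,y\in X$ satisfy $d(x,y)\leq\delta$. $f$ satisfies property (CW) if $\inf_{n\in\mathbb{Z}}dist(f^n(x),f^n(C))>0$ for every $x\in X$ and every subcontinuum $C$ of $X$ with $x\notin C$. $X$ is semi-locally connected at $p\in X$ if for every open neighborhood $U$ of $p$ there is an open neighborhood $V\subset U$ of $p$ such that $X\setminus U$ is contained in the union of finitely many connected components of $X\setminus V$. $X$ is semi-locally connected if it is semi-locally connected at every $p\in X$. *)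

theory Defs
  imports "HOL-Analysis.Analysis"
begin

text \<open>
  A compact metric space is rendered as a compact set \<open>X\<close> in a type of class
  \<open>metric_space\<close>. Its topology is the subspace topology \<open>top_of_set X\<close>, and maps
  \<open>X \<rightarrow> X\<close> are functions of which only the values on \<open>X\<close> matter.
\<close>

text \<open>The inverse is taken on \<open>X\<close> only, so the negative iterates are meaningful when
  \<open>f\<close> is a bijection of \<open>X\<close> and the argument lies in \<open>X\<close>.\<close>

definition int_iterate :: "'a set \<Rightarrow> ('a \<Rightarrow> 'a) \<Rightarrow> int \<Rightarrow> 'a \<Rightarrow> 'a" where
  "int_iterate X f n =
     (if n \<ge> 0 then f ^^ nat n else inv_into X f ^^ nat (- n))"

definition subcontinuum :: "'a::topological_space set \<Rightarrow> 'a set \<Rightarrow> bool" where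
  "subcontinuum X C \<longleftrightarrow> C \<subseteq> X \<and> C \<noteq> {} \<and> compact C \<and> connected C"

definition equicontinuous_homeo :: "'a::metric_space set \<Rightarrow> ('a \<Rightarrow> 'a) \<Rightarrow> bool" where
  "equicontinuous_homeo X f \<longleftrightarrow>
     (\<forall>\<epsilon>>0. \<exists>\<delta>>0. \<forall>x\<in>X. \<forall>y\<in>X. dist x y \<le> \<delta> \<longrightarrow>
        (\<forall>n. dist (int_iterate X f n x) (int_iterate X f n y) \<le> \<epsilon>))"

definition property_CW :: "'a::metric_space set \<Rightarrow> ('a \<Rightarrow> 'a) \<Rightarrow> bool" where
  "property_CW X f \<longleftrightarrow>
     (\<forall>x\<in>X. \<forall>C. subcontinuum X C \<and> x \<notin> C \<longrightarrow>
        (INF n. infdist (int_iterate X f n x) (int_iterate X f n ` C)) > 0)"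

definition semi_locally_connected_at :: "'a::topological_space set \<Rightarrow> 'a \<Rightarrow> bool" where
  "semi_locally_connected_at X p \<longleftrightarrow>
     (\<forall>U. openin (top_of_set X) U \<and> p \<in> U \<longrightarrow>
        (\<exists>V. openin (top_of_set X) V \<and> p \<in> V \<and> V \<subseteq> U \<and>
           (\<exists>K. finite K \<and> K \<subseteq> components (X - V) \<and> X - U \<subseteq> \<Union>K)))"

definition semi_locally_connected :: "'a::topological_space set \<Rightarrow> bool" where
  "semi_locally_connected X \<longleftrightarrow> (\<forall>p\<in>X. semi_locally_connected_at X p)"

end

(*
  Semi-local connectedness turns property (CW) into the pointwise condition that points at
  distance at least rho from z keep, under all iterates, a positive distance eta(z, rho) from
  the orbit of z: finitely many subcontinua missing z cover the complement of the rho-ball.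
  For sequences this says: if f^(m_k)(z) and p_k both tend to p, then f^(-m_k)(p_k) tends to z.
  With p_k = p we get f^(-m_k)(p) -> z, and applying the principle once more at p
  shows that f^(m_k)(z_k) -> p whenever z_k -> z. By compactness this is equicontinuity.
*)
theory Submission
  imports Defs
begin

lemma funpow_mem:
  assumes "\<And>x. x \<in> X \<Longrightarrow> g x \<in> X" "x \<in> X"
  shows "(g ^^ k) x \<in> X"
  using assms by (induction k) auto

lemma funpow_left_inverse:
  assumes "\<And>x. x \<in> X \<Longrightarrow> g x \<in> X" "\<And>x. x \<in> X \<Longrightarrow> h (g x) = x" "x \<in> X"
  shows "(h ^^ k) ((g ^^ k) x) = x"
proof (induction k)
  case (Suc k)
  have "(g ^^ k) x \<in> X"
    using assms(1,3) by (rule funpow_mem)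
  moreover have "(h ^^ Suc k) ((g ^^ Suc k) x) = (h ^^ k) (h (g ((g ^^ k) x)))"
    by (simp add: funpow_swap1)
  ultimately show ?case
    using Suc assms(2) by simp
qed simp

lemma int_iterate_mem:
  assumes "bij_betw f X X" "x \<in> X"
  shows "int_iterate X f n x \<in> X"
proof -
  have "f y \<in> X" "inv_into X f y \<in> X" if "y \<in> X" for y
    using that assms(1) bij_betwE bij_betw_inv_into by blast+
  then show ?thesis
    using assms(2) by (simp add: int_iterate_def funpow_mem)
qed

lemma int_iterate_minus_cancel:
  assumes "bij_betw f X X" "x \<in> X"
  shows "int_iterate X f (- n) (int_iterate X f n x) = x"
proof -
  have mem: "f y \<in> X" "inv_into X f y \<in> X" if "y \<in> X" for y
    using that assms(1) bij_betwE bij_betw_inv_into by blast+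
  have inv: "inv_into X f (f y) = y" "f (inv_into X f y) = y" if "y \<in> X" for y
    using that assms(1)
    by (auto intro: bij_betw_inv_into_left bij_betw_inv_into_right)
  have "(inv_into X f ^^ k) ((f ^^ k) x) = x" "(f ^^ k) ((inv_into X f ^^ k) x) = x" for k
    by (rule funpow_left_inverse[where X = X]; use mem inv assms(2) in simp)+
  then show ?thesis
    \<comment> \<open>For \<open>n = 0\<close> both exponents fall into the nonnegative branch;
      otherwise exactly one of \<open>n\<close> and \<open>- n\<close> does.\<close>
    by (cases "n = 0") (auto simp: int_iterate_def)
qed

lemma int_iterate_minus_cancel':
  assumes "bij_betw f X X" "x \<in> X"
  shows "int_iterate X f n (int_iterate X f (- n) x) = x"
  using int_iterate_minus_cancel[OF assms, of "- n"] by simp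

text \<open>If the \<open>n\<close>-th images of \<open>x\<close> and some \<open>c\<close> in
  \<open>C\<close> were too close, equicontinuity applied to the iterate \<open>- n\<close> would
  bring \<open>x\<close> and \<open>c\<close> themselves closer than \<open>C\<close> allows. The
  modulus \<open>d\<close> is therefore a lower bound for all \<open>n\<close> at once.\<close>

lemma equicontinuous_imp_property_CW:
  assumes bij: "bij_betw f X X" and equi: "equicontinuous_homeo X f"
  shows "property_CW X f"
  unfolding property_CW_def
proof (intro ballI allI impI)
  fix x C
  assume x: "x \<in> X" and C: "subcontinuum X C \<and> x \<notin> C"
  let ?F = "int_iterate X f"
  have CX: "C \<subseteq> X" "C \<noteq> {}" "closed C"
    using C compact_imp_closed by (auto simp: subcontinuum_def)
  \<comment> \<open>Halving makes \<open>dist x c \<le> e\<close> strictly smaller than the distance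
    from \<open>x\<close> to \<open>C\<close>.\<close>
  define e where "e = infdist x C / 2"
  have e: "e > 0" "2 * e = infdist x C"
    using CX C infdist_pos_not_in_closed[of C x] by (auto simp: e_def)
  obtain d where d: "d > 0"
    "\<And>x y n. x \<in> X \<Longrightarrow> y \<in> X \<Longrightarrow> dist x y \<le> d \<Longrightarrow> dist (?F n x) (?F n y) \<le> e"
    using equi e(1) unfolding equicontinuous_homeo_def by blast
  have "d \<le> infdist (?F n x) (?F n ` C)" for n
  proof -
    have "d \<le> dist (?F n x) (?F n c)" if c: "c \<in> C" for c
    proof (rule ccontr)
      assume "\<not> ?thesis"
      moreover have "c \<in> X"
        using c CX by blast
      ultimately have "dist (?F (- n) (?F n x)) (?F (- n) (?F n c)) \<le> e"
        using x by (intro d(2) int_iterate_mem[OF bij]) auto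
      then have "dist x c \<le> e"
        using x \<open>c \<in> X\<close> by (simp add: int_iterate_minus_cancel[OF bij])
      then show False
        using infdist_le[OF c, of x] e by linarith
    qed
    then show ?thesis
      using CX(2) by (auto simp: infdist_def intro!: cINF_greatest)
  qed
  then have "d \<le> (INF n. infdist (?F n x) (?F n ` C))"
    by (intro cINF_greatest) auto
  then show "0 < (INF n. infdist (?F n x) (?F n ` C))"
    using d(1) by linarith
qed

lemma property_CW_subcontinuum:
  assumes "property_CW X f" "x \<in> X" "subcontinuum X C" "x \<notin> C"
  obtains \<eta> where "\<eta> > 0"
    "\<And>w n. w \<in> C \<Longrightarrow> \<eta> \<le> dist (int_iterate X f n x) (int_iterate X f n w)"
proof
  let ?I = "\<lambda>n. infdist (int_iterate X f n x) (int_iterate X f n ` C)"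
  show "(INF n. ?I n) > 0"
    using assms by (auto simp: property_CW_def)
  fix w n
  assume w: "w \<in> C"
  have "(INF n. ?I n) \<le> ?I n"
    \<comment> \<open>A real infimum is a lower bound only for a family bounded below; here 0 bounds
      it.\<close>
    by (intro cINF_lower bdd_belowI2[where m = 0]) (auto simp: infdist_nonneg)
  also have "\<dots> \<le> dist (int_iterate X f n x) (int_iterate X f n w)"
    using w by (simp add: infdist_le)
  finally show "(INF n. ?I n) \<le> dist (int_iterate X f n x) (int_iterate X f n w)" .
qed

text \<open>Components are closed in \<open>X - V\<close>, which is itself closed in the compact
  \<open>X\<close>. This makes the pieces supplied by semi-local connectedness admissible in
  property (CW).\<close>

lemma component_subcontinuum:
  assumes "compact X" "openin (top_of_set X) V" "C \<in> components (X - V)"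
  shows "subcontinuum X C"
proof -
  have "closedin (top_of_set X) (X - V)"
    using assms(2) by (simp add: closedin_diff)
  then have "compact (X - V)"
    using assms(1) closedin_compact by blast
  then have "compact C"
    using assms(3) closedin_component closedin_compact by blast
  then show ?thesis
    using assms(3) in_components_nonempty in_components_connected in_components_subset
    unfolding subcontinuum_def by blast
qed

text \<open>Finiteness of the cover is decisive: (CW) gives one positive constant per component, and
  finitely many have a positive minimum. The resulting \<open>\<eta>\<close> may depend on
  \<open>z\<close> but not on \<open>n\<close>.\<close>

lemma property_CW_pointwise_separation:
  assumes "compact X" "semi_locally_connected X" "property_CW X f" "z \<in> X" "\<rho> > 0"
  obtains \<eta> where "\<eta> > 0"
    "\<And>w n. w \<in> X \<Longrightarrow> \<rho> \<le> dist z w \<Longrightarrow> \<eta> \<le> dist (int_iterate X f n z) (int_iterate X f n w)"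
proof -
  let ?U = "X \<inter> ball z \<rho>"
  have "openin (top_of_set X) ?U" "z \<in> ?U"
    using assms(4,5) by (auto simp: openin_open_Int)
  then obtain V K where V: "openin (top_of_set X) V" "z \<in> V"
    and K: "finite K" "K \<subseteq> components (X - V)" "X - ?U \<subseteq> \<Union>K"
    using assms(2,4) unfolding semi_locally_connected_def semi_locally_connected_at_def by meson
  have "\<exists>\<eta>>0. \<forall>w\<in>C. \<forall>n. \<eta> \<le> dist (int_iterate X f n z) (int_iterate X f n w)"
    if "C \<in> K" for C
  proof -
    have "z \<notin> C"
      using that K(2) V(2) in_components_subset by blast
    moreover have "subcontinuum X C"
      using that K(2) component_subcontinuum[OF assms(1) V(1)] by blast
    ultimately show ?thesis
      using property_CW_subcontinuum[OF assms(3,4)] by metis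
  qed
  then obtain \<eta> where \<eta>: "\<And>C. C \<in> K \<Longrightarrow> \<eta> C > 0"
    "\<And>C w n. C \<in> K \<Longrightarrow> w \<in> C \<Longrightarrow> \<eta> C \<le> dist (int_iterate X f n z) (int_iterate X f n w)"
    by metis
  \<comment> \<open>The extra 1 keeps \<open>Min\<close> meaningful when \<open>K\<close> is empty,
    as can happen if the ball contains \<open>X\<close>.\<close>
  define m where "m = Min (insert 1 (\<eta> ` K))"
  have "m > 0"
    using K(1) \<eta>(1) by (auto simp: m_def)
  moreover have "m \<le> dist (int_iterate X f n z) (int_iterate X f n w)"
    if "w \<in> X" "\<rho> \<le> dist z w" for w n
  proof -
    obtain C where C: "C \<in> K" "w \<in> C"
      using \<open>w \<in> X\<close> \<open>\<rho> \<le> dist z w\<close> K(3) by fastforce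
    have "m \<le> \<eta> C"
      using C K(1) by (simp add: m_def)
    then show ?thesis
      using \<eta>(2)[OF C] order_trans by blast
  qed
  ultimately show thesis
    by (rule that)
qed

text \<open>The separation bound is read contrapositively at the preimage of \<open>q k\<close>
  under the iterate \<open>m k\<close>. Since \<open>\<eta>\<close> is uniform in the exponent, the
  exponents \<open>m k\<close> may vary arbitrarily.\<close>

lemma property_CW_backward_limit:
  assumes "compact X" "semi_locally_connected X" "property_CW X f" and bij: "bij_betw f X X"
    and "z \<in> X" and q: "\<And>k. q k \<in> X"
    and "(\<lambda>k. int_iterate X f (m k) z) \<longlonglongrightarrow> p" and "q \<longlonglongrightarrow> p"
  shows "(\<lambda>k. int_iterate X f (- m k) (q k)) \<longlonglongrightarrow> z"
proof (rule tendstoI)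
  fix \<rho> :: real
  assume "\<rho> > 0"
  then obtain \<eta> where \<eta>: "\<eta> > 0" "\<And>w n. w \<in> X \<Longrightarrow> \<rho> \<le> dist z w \<Longrightarrow>
      \<eta> \<le> dist (int_iterate X f n z) (int_iterate X f n w)"
    using property_CW_pointwise_separation[OF assms(1-3) \<open>z \<in> X\<close>] by metis
  have "(\<lambda>k. dist (int_iterate X f (m k) z) (q k)) \<longlonglongrightarrow> dist p p"
    using assms(7,8) by (rule tendsto_dist)
  then have "eventually (\<lambda>k. dist (int_iterate X f (m k) z) (q k) < \<eta>) sequentially"
    using \<eta>(1) by (intro order_tendstoD(2)) auto
  then show "eventually (\<lambda>k. dist (int_iterate X f (- m k) (q k)) z < \<rho>) sequentially"
  proof eventually_elim
    case (elim k)
    then show ?case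
      using \<eta>(2)[OF int_iterate_mem[OF bij q], of "- m k" k "m k"]
      by (auto simp: int_iterate_minus_cancel'[OF bij q] dist_commute not_le[symmetric])
  qed
qed

lemma property_CW_forward_limit:
  assumes "compact X" "semi_locally_connected X" "property_CW X f" "bij_betw f X X"
    and "z \<in> X" "p \<in> X" "\<And>k. y k \<in> X"
    and "(\<lambda>k. int_iterate X f (m k) z) \<longlonglongrightarrow> p" "y \<longlonglongrightarrow> z"
  shows "(\<lambda>k. int_iterate X f (m k) (y k)) \<longlonglongrightarrow> p"
proof -
  have "(\<lambda>k. int_iterate X f (- m k) p) \<longlonglongrightarrow> z"
    using property_CW_backward_limit[OF assms(1-5) _ assms(8), of "\<lambda>_. p"] assms(6) by simp
  then show ?thesis
    \<comment> \<open>The roles are exchanged: \<open>p\<close> is now the base point,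
      \<open>z\<close> the common limit, and the exponents are negated.\<close>
    using property_CW_backward_limit[OF assms(1-4) assms(6), of y "\<lambda>k. - m k" z] assms(7,9)
    by simp
qed

lemma property_CW_imp_equicontinuous:
  assumes "compact X" "semi_locally_connected X" "property_CW X f" "bij_betw f X X"
  shows "equicontinuous_homeo X f"
proof (rule ccontr)
  let ?F = "int_iterate X f"
  assume "\<not> ?thesis"
  then obtain e where e: "e > 0" and
    "\<forall>d>0. \<exists>x\<in>X. \<exists>y\<in>X. dist x y \<le> d \<and> (\<exists>n. \<not> dist (?F n x) (?F n y) \<le> e)"
    unfolding equicontinuous_homeo_def by blast
  then have "\<forall>k. \<exists>x y n. x \<in> X \<and> y \<in> X \<and> dist x y \<le> inverse (real (Suc k)) \<and>
      e < dist (?F n x) (?F n y)"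
    by (metis not_le inverse_positive_iff_positive of_nat_0_less_iff zero_less_Suc)
  then obtain x y n where xy: "\<And>k. x k \<in> X" "\<And>k. y k \<in> X"
    "\<And>k. dist (x k) (y k) \<le> inverse (real (Suc k))"
    "\<And>k. e < dist (?F (n k) (x k)) (?F (n k) (y k))"
    by metis
  obtain z r where r: "z \<in> X" "strict_mono r" "(x \<circ> r) \<longlonglongrightarrow> z"
    using assms(1) xy(1) unfolding compact_def by blast
  \<comment> \<open>The second extraction follows the images of the limit point \<open>z\<close>,
    not those of \<open>x\<close> or \<open>y\<close>; one limit \<open>p\<close> then serves both
    sequences.\<close>
  have "\<forall>k. ?F (n (r k)) z \<in> X"
    using int_iterate_mem[OF assms(4) r(1)] by blast
  then obtain p s where s: "p \<in> X" "strict_mono s"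
      "((\<lambda>k. ?F (n (r k)) z) \<circ> s) \<longlonglongrightarrow> p"
    using assms(1) unfolding compact_def by meson
  define t where "t = r \<circ> s"
  have t: "strict_mono t" "(\<lambda>k. x (t k)) \<longlonglongrightarrow> z" "(\<lambda>k. ?F (n (t k)) z) \<longlonglongrightarrow> p"
    using r s LIMSEQ_subseq_LIMSEQ[OF r(3) s(2)]
    by (auto simp: t_def o_def strict_mono_def)
  have "(\<lambda>k. dist (x k) (y k)) \<longlonglongrightarrow> 0"
    by (rule tendsto_sandwich[OF _ _ tendsto_const LIMSEQ_inverse_real_of_nat])
       (use xy(3) in auto)
  then have "(\<lambda>k. dist (x (t k)) (y (t k))) \<longlonglongrightarrow> 0"
    using LIMSEQ_subseq_LIMSEQ[OF _ t(1)] by (force simp: o_def)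
  \<comment> \<open>By the triangle inequality this sum dominates the distance from
    \<open>y (t k)\<close> to \<open>z\<close>.\<close>
  then have "(\<lambda>k. dist (x (t k)) (y (t k)) + dist (x (t k)) z) \<longlonglongrightarrow> 0"
    using tendsto_add_zero t(2) tendsto_dist_iff by blast
  then have yt: "(\<lambda>k. y (t k)) \<longlonglongrightarrow> z"
    by (rule metric_tendsto_imp_tendsto) (simp add: dist_triangle3)
  note lim = property_CW_forward_limit[OF assms r(1) s(1) _ t(3)]
  have "(\<lambda>k. dist (?F (n (t k)) (x (t k))) (?F (n (t k)) (y (t k)))) \<longlonglongrightarrow> dist p p"
    using lim[OF _ t(2)] lim[OF _ yt] xy(1,2) by (intro tendsto_dist) auto
  \<comment> \<open>The images stay more than \<open>e\<close> apart, yet both sequences of images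
    tend to \<open>p\<close>; the strict bound becomes \<open>\<le>\<close> in the limit.\<close>
  then have "e \<le> dist p p"
    using xy(4) by (intro LIMSEQ_le_const) (auto intro: less_imp_le)
  then show False
    using e by simp
qed

theorem theorem1p2:
  fixes X :: "'a::metric_space set" and f :: "'a \<Rightarrow> 'a"
  assumes "compact X"
    and "semi_locally_connected X"
    and "\<exists>g. homeomorphism X X f g"
  shows "equicontinuous_homeo X f \<longleftrightarrow> property_CW X f"
proof -
  have "bij_betw f X X"
    using assms(3) by (auto simp: homeomorphism_def bij_betw_def intro: inj_on_inverseI)
  then show ?thesis
    using assms(1,2) equicontinuous_imp_property_CW property_CW_imp_equicontinuous by blast
qed

end
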